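(* Consider an ILP instance: minimize $obj(x)=c^\top x$ subject to $Ax\le b$, $x\in\mathbb{Z}^n$, where $A\in\mathbb{R}^{m\times n}$, $b\in\mathbb{R}^m$, $c\in\mathbb{R}^n$. Assume that $c_j\neq 0$ for at least one $j$, that no variable is free, and that the instance has a finite optimal solution and a finite optimal objective value. Let $P=\{x\in\mathbb{R}^n \mid Ax\le b\}$. Then every optimal solution of the instance is a boundary solution, i.e. belongs to $\delta(P)$, and $$\min_{x\in P\cap\mathbb{Z}^n} obj(x)=\min_{x\in\delta(P)\cap\mathbb{Z}^n} obj(x).$$
   Context: Let $e_j\in\mathbb{R}^n$ be the $j$-th unit vector, $J=\{1,\dots,n\}$ and $U=\bigcup_{j\in J}\{e_j,-e_j\}$. For $P=\{x\in\mathbb{R}^n\mid Ax\le b\}$, a point $x\in\mathbb{Z}^n$ is a boundary point of $P$ if $x\in P$ and there exists $d\in U$ with $x+d\notin P$; the set of boundary points is denoted $\delta(P)$ (so $\delta(P)\subseteq\mathbb{Z}^n$). A boundary solution of the ILP is a boundary point of $P$. All bounds on variables are included among the rows of $Ax\le b$. A variable is free if it does not appear in any constraint, has both bounds infinite, and does not appear in $c^\top x$. *)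

theory Defs
  imports "HOL-Analysis.Analysis"
begin

text \<open>
  The order on \<^typ>\<open>real ^ 'm\<close> is componentwise, so \<^term>\<open>A *v x \<le> b\<close> is the usual system of
  linear inequalities. Bounds on variables are rows of this system.
\<close>

definition LP_polyhedron :: "real ^ 'n ^ 'm \<Rightarrow> real ^ 'm \<Rightarrow> (real ^ 'n) set" where
  "LP_polyhedron A b = {x. A *v x \<le> b}"

definition int_points :: "(real ^ 'n) set" where
  "int_points = {x. \<forall>j. x $ j \<in> \<int>}"

definition unit_steps :: "(real ^ 'n) set" where
  "unit_steps = (\<Union>j. {axis j 1, - axis j 1})"

definition boundary_points :: "(real ^ 'n) set \<Rightarrow> (real ^ 'n) set" where
  "boundary_points P = {x \<in> int_points. x \<in> P \<and> (\<exists>d\<in>unit_steps. x + d \<notin> P)}"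

definition obj :: "real ^ 'n \<Rightarrow> real ^ 'n \<Rightarrow> real" where
  "obj c x = c \<bullet> x"

text \<open>
  Since a finite bound on \<open>x\<^sub>j\<close> is a row of \<open>A\<close> with a nonzero entry in column \<open>j\<close>, a zero
  column means both that \<open>x\<^sub>j\<close> appears in no constraint and that both its bounds are infinite.
\<close>

definition free_variable :: "real ^ 'n ^ 'm \<Rightarrow> real ^ 'n \<Rightarrow> 'n \<Rightarrow> bool" where
  "free_variable A c j \<longleftrightarrow> (\<forall>i. A $ i $ j = 0) \<and> c $ j = 0"

definition optimal_solution ::
    "real ^ 'n ^ 'm \<Rightarrow> real ^ 'm \<Rightarrow> real ^ 'n \<Rightarrow> real ^ 'n \<Rightarrow> bool" where
  "optimal_solution A b c x \<longleftrightarrow> is_arg_min (obj c) (\<lambda>y. y \<in> LP_polyhedron A b \<inter> int_points) x"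

text \<open>
  The feasible set may be infinite, so \<^const>\<open>Min\<close> is not applicable; the relation below also
  asserts that the minimum is attained.
\<close>

definition has_min :: "('a \<Rightarrow> real) \<Rightarrow> 'a set \<Rightarrow> real \<Rightarrow> bool" where
  "has_min f S v \<longleftrightarrow> v \<in> f ` S \<and> (\<forall>x\<in>S. v \<le> f x)"

end

theory Submission
  imports Defs
begin

text \<open>
  A linear objective with a nonzero coefficient can be strictly decreased from every integer point
  by a single unit step, namely along the corresponding coordinate axis against the sign of that
  coefficient. The step stays on the integer lattice, so at an optimal solution it has to
  leave the polyhedron; this is exactly what makes the optimal solution a boundary point. The two
  minima then agree, because the boundary points form a subset of the feasible integer points and
  this subset contains a minimiser over the whole set.
\<close>

lemma int_points_add_unit_step:
  assumes "x \<in> int_points" "d \<in> unit_steps"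
  shows "x + d \<in> int_points"
  using assms by (auto simp: int_points_def unit_steps_def axis_def)

lemma ex_decreasing_unit_step:
  assumes "c $ j \<noteq> 0"
  shows "\<exists>d\<in>unit_steps. obj c (x + d) < obj c x"
proof (cases "c $ j > 0")
  case True
  then have "obj c (x + - axis j 1) < obj c x"
    by (simp add: obj_def inner_diff_right inner_axis)
  then show ?thesis
    unfolding unit_steps_def by blast
next
  case False
  with assms have "obj c (x + axis j 1) < obj c x"
    by (simp add: obj_def inner_add_right inner_axis)
  then show ?thesis
    unfolding unit_steps_def by blast
qed

lemma optimal_solution_iff:
  "optimal_solution A b c x \<longleftrightarrow>
     x \<in> LP_polyhedron A b \<inter> int_points \<and>
     (\<forall>y\<in>LP_polyhedron A b \<inter> int_points. obj c x \<le> obj c y)"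
  by (auto simp: optimal_solution_def is_arg_min_def not_less)

text \<open>
  An improving unit step cannot lead to another feasible integer point, and integrality survives
  the step, so the step violates the constraints.
\<close>

lemma optimal_solution_in_boundary_points:
  assumes "c $ j \<noteq> 0" and opt: "optimal_solution A b c x"
  shows "x \<in> boundary_points (LP_polyhedron A b)"
proof -
  obtain d where d: "d \<in> unit_steps" "obj c (x + d) < obj c x"
    using ex_decreasing_unit_step[OF assms(1)] by blast
  have x: "x \<in> LP_polyhedron A b" "x \<in> int_points"
    using opt by (auto simp: optimal_solution_iff)
  have "x + d \<in> int_points"
    using x(2) d(1) by (rule int_points_add_unit_step)
  then have "x + d \<notin> LP_polyhedron A b"
    using opt d(2) by (force simp: optimal_solution_iff)
  with x d(1) show ?thesis
    by (auto simp: boundary_points_def)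
qed

theorem proposition1:
  fixes A :: "real ^ 'n ^ 'm" and b :: "real ^ 'm" and c :: "real ^ 'n"
  assumes "\<exists>j. c $ j \<noteq> 0"
    and "\<forall>j. \<not> free_variable A c j"
    and "\<exists>x. optimal_solution A b c x"
  shows "(\<forall>x. optimal_solution A b c x \<longrightarrow> x \<in> boundary_points (LP_polyhedron A b)) \<and>
         (\<exists>v. has_min (obj c) (LP_polyhedron A b \<inter> int_points) v \<and>
              has_min (obj c) (boundary_points (LP_polyhedron A b) \<inter> int_points) v)"
proof -
  let ?F = "LP_polyhedron A b \<inter> int_points"
  let ?B = "boundary_points (LP_polyhedron A b) \<inter> int_points"
  have boundary: "x \<in> boundary_points (LP_polyhedron A b)" if "optimal_solution A b c x" for x
    using assms(1) that optimal_solution_in_boundary_points by blast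
  obtain x where opt: "optimal_solution A b c x"
    using assms(3) by blast
  then have x: "x \<in> ?F" and le: "\<forall>y\<in>?F. obj c x \<le> obj c y"
    by (simp_all add: optimal_solution_iff)
  have sub: "?B \<subseteq> ?F"
    by (auto simp: boundary_points_def)
  have "has_min (obj c) ?F (obj c x)"
    using x le by (simp add: has_min_def)
  moreover have "has_min (obj c) ?B (obj c x)"
    using x le sub boundary[OF opt] by (auto simp: has_min_def)
  ultimately show ?thesis
    using boundary by blast
qed

end
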